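(* Let $r\ge 1$ and let the colors be $1<2<\dots<r$. Let $T(x,y)$ denote either the system of Whittaker Boltzmann weights or the system of K-theoretic Boltzmann weights, and let $R(x_i,x_j)$ denote the R-vertex weights (all listed in the context). Then the Yang–Baxter equation holds: for every choice of horizontal spins $a,b,d,e\in\{+,1,\dots,r\}$ and vertical spins $c,f\subseteq\{1,\dots,r\}$, $$\sum_{p,p',\Gamma} R_{x_i,x_j}(a,b;p,p')\,T_{x_i,y}(p,c;d,\Gamma)\,T_{x_j,y}(p',\Gamma;e,f)=\sum_{p,p',\Gamma} T_{x_j,y}(b,c;p,\Gamma)\,T_{x_i,y}(a,\Gamma;p',f)\,R_{x_i,x_j}(p',p;d,e),$$ where $p,p'$ run over $\{+,1,\dots,r\}$ and $\Gamma$ runs over the subsets of $\{1,\dots,r\}$.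
   Context: $t,x_i,x_j,y$ are indeterminates. Horizontal spins are elements of $\{+,1,\dots,r\}$ ($+$ means "no color"); vertical spins are subsets of the color set $\{1,\dots,r\}$. For a set $\Sigma$ of colors, $\Sigma_{>c}$, $\Sigma_{<c}$, $\Sigma_{(c,d)}$ denote the subsets of elements $>c$, $<c$, strictly between $c$ and $d$. $T_{x,y}(L,\Sigma;L',\Sigma')$ is the weight of a vertex with left spin $L$, top spin $\Sigma$, right spin $L'$, bottom spin $\Sigma'$. It is $0$ unless listed. Whittaker weights: (1) $T(+,\Sigma;+,\Sigma)=(-t)^{|\Sigma|}$. (2) $T(c,\Sigma;c,\Sigma)=t^{|\Sigma_{>c}|}(x+t^{\delta}y)$, where $\delta=1$ if $c\in\Sigma$ and $\delta=0$ otherwise. (3) For $c\in\Sigma$: $T(+,\Sigma;c,\Sigma\setminus\{c\})=(-t)^{|\Sigma_{<c}|}t^{|\Sigma_{>c}|}$. (4) For $c\notin\Sigma$: $T(c,\Sigma;+,\Sigma\cup\{c\})=(1-t)x(-t)^{|\Sigma_{>c}|}$. (5) For $c<d$, $d\in\Sigma$, $c\notin\Sigma$: $T(c,\Sigma;d,(\Sigma\cup\{c\})\setminus\{d\})=(1-t)x(-t)^{|\Sigma_{(c,d)}|}t^{|\Sigma_{>d}|}$. (6) For $c<d$, $c\in\Sigma$, $d\notin\Sigma$: $T(d,\Sigma;c,(\Sigma\cup\{d\})\setminus\{c\})=-y(1-t)(-1)^{|\Sigma_{(c,d)}|}t^{|\Sigma_{>d}|}$. K-theoretic weights: obtained from the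 Whittaker weights by dividing by $y$ each weight whose left spin is a color, and then replacing $x$ by $-x$. Thus (1) and (3) are unchanged; (2) becomes $t^{|\Sigma_{>c}|}(-xy^{-1}+t^{\delta})$; (4) becomes $-(1-t)xy^{-1}(-t)^{|\Sigma_{>c}|}$; (5) becomes $-(1-t)xy^{-1}(-t)^{|\Sigma_{(c,d)}|}t^{|\Sigma_{>d}|}$; (6) becomes $-(1-t)(-1)^{|\Sigma_{(c,d)}|}t^{|\Sigma_{>d}|}$. R-weights: $R_{x_i,x_j}(a,b;p,p')$ is the weight of the crossing with bottom-left spin $a$, top-left spin $b$, top-right spin $p$, bottom-right spin $p'$ (all horizontal spins). It is $0$ unless listed; here $c<d$ are colors: $R(+,+;+,+)=x_j-tx_i$; $R(c,c;c,c)=x_i-tx_j$; $R(c,+;+,c)=(1-t)x_i$; $R(+,c;c,+)=(1-t)x_j$; $R(+,c;+,c)=t(x_i-x_j)$; $R(c,+;c,+)=x_i-x_j$; $R(c,d;d,c)=(1-t)x_i$; $R(c,d;c,d)=t(x_i-x_j)$; $R(d,c;c,d)=(1-t)x_j$; $R(d,c;d,c)=x_i-x_j$. In the left side of the equation, the R-vertex is to the left of two stacked vertices in one column (top vertex with row parameter $x_i$, bottom with $x_j$); in the right side, the R-vertex is to the right of two stacked vertices (top with $x_j$, bottom with $x_i$). *)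

theory Defs
  imports Main
begin

text \<open>
  A horizontal spin is \<open>Plus\<close> (no color) or a color. With \<open>r\<close> colors, the horizontal spins are
  the elements of \<open>hspins r\<close> and the vertical spins are the subsets of \<open>{1..r}\<close>.
\<close>

datatype hspin = Plus | Color nat

definition hspins :: "nat \<Rightarrow> hspin set" where
  "hspins r = insert Plus (Color ` {1..r})"

text \<open>
  Argument order of the vertex weights: left, top, right, bottom. The parameters \<open>t\<close>, \<open>x\<close>, \<open>y\<close> range
  over an arbitrary field; the indeterminates are the special case of a field of rational functions.
\<close>

fun whittaker_weight ::
  "'a::field \<Rightarrow> 'a \<Rightarrow> 'a \<Rightarrow> hspin \<Rightarrow> nat set \<Rightarrow> hspin \<Rightarrow> nat set \<Rightarrow> 'a" where
  "whittaker_weight t x y Plus \<Sigma> Plus \<Sigma>' =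
    (if \<Sigma>' = \<Sigma> then (- t) ^ card \<Sigma> else 0)"
| "whittaker_weight t x y Plus \<Sigma> (Color c) \<Sigma>' =
    (if c \<in> \<Sigma> \<and> \<Sigma>' = \<Sigma> - {c}
     then (- t) ^ card (\<Sigma> \<inter> {..<c}) * t ^ card (\<Sigma> \<inter> {c<..}) else 0)"
| "whittaker_weight t x y (Color c) \<Sigma> Plus \<Sigma>' =
    (if c \<notin> \<Sigma> \<and> \<Sigma>' = \<Sigma> \<union> {c}
     then (1 - t) * x * (- t) ^ card (\<Sigma> \<inter> {c<..}) else 0)"
| "whittaker_weight t x y (Color a) \<Sigma> (Color b) \<Sigma>' =
    (if a = b then
       (if \<Sigma>' = \<Sigma>
        then t ^ card (\<Sigma> \<inter> {a<..}) * (x + t ^ (if a \<in> \<Sigma> then 1 else 0) * y) else 0)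
     else if a < b then
       (if b \<in> \<Sigma> \<and> a \<notin> \<Sigma> \<and> \<Sigma>' = (\<Sigma> \<union> {a}) - {b}
        then (1 - t) * x * (- t) ^ card (\<Sigma> \<inter> {a<..<b}) * t ^ card (\<Sigma> \<inter> {b<..}) else 0)
     else
       (if b \<in> \<Sigma> \<and> a \<notin> \<Sigma> \<and> \<Sigma>' = (\<Sigma> \<union> {a}) - {b}
        then - y * (1 - t) * (- 1) ^ card (\<Sigma> \<inter> {b<..<a}) * t ^ card (\<Sigma> \<inter> {a<..}) else 0))"

definition ktheoretic_weight ::
  "'a::field \<Rightarrow> 'a \<Rightarrow> 'a \<Rightarrow> hspin \<Rightarrow> nat set \<Rightarrow> hspin \<Rightarrow> nat set \<Rightarrow> 'a" where
  "ktheoretic_weight t x y L \<Sigma> L' \<Sigma>' =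
    (case L of
       Plus \<Rightarrow> whittaker_weight t (- x) y L \<Sigma> L' \<Sigma>'
     | Color c \<Rightarrow> whittaker_weight t (- x) y L \<Sigma> L' \<Sigma>' / y)"

lemma ktheoretic_weight_explicit:
  fixes t x y :: "'a::field"
  assumes "y \<noteq> 0"
  shows
    "ktheoretic_weight t x y Plus \<Sigma> Plus \<Sigma>' =
      (if \<Sigma>' = \<Sigma> then (- t) ^ card \<Sigma> else 0)"
    "ktheoretic_weight t x y Plus \<Sigma> (Color c) \<Sigma>' =
      (if c \<in> \<Sigma> \<and> \<Sigma>' = \<Sigma> - {c}
       then (- t) ^ card (\<Sigma> \<inter> {..<c}) * t ^ card (\<Sigma> \<inter> {c<..}) else 0)"
    "ktheoretic_weight t x y (Color c) \<Sigma> Plus \<Sigma>' =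
      (if c \<notin> \<Sigma> \<and> \<Sigma>' = \<Sigma> \<union> {c}
       then - (1 - t) * x * inverse y * (- t) ^ card (\<Sigma> \<inter> {c<..}) else 0)"
    "ktheoretic_weight t x y (Color c) \<Sigma> (Color c) \<Sigma>' =
      (if \<Sigma>' = \<Sigma>
       then t ^ card (\<Sigma> \<inter> {c<..}) * (- x * inverse y + t ^ (if c \<in> \<Sigma> then 1 else 0)) else 0)"
    "c < d \<Longrightarrow> ktheoretic_weight t x y (Color c) \<Sigma> (Color d) \<Sigma>' =
      (if d \<in> \<Sigma> \<and> c \<notin> \<Sigma> \<and> \<Sigma>' = (\<Sigma> \<union> {c}) - {d}
       then - (1 - t) * x * inverse y * (- t) ^ card (\<Sigma> \<inter> {c<..<d}) * t ^ card (\<Sigma> \<inter> {d<..})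
       else 0)"
    "c < d \<Longrightarrow> ktheoretic_weight t x y (Color d) \<Sigma> (Color c) \<Sigma>' =
      (if c \<in> \<Sigma> \<and> d \<notin> \<Sigma> \<and> \<Sigma>' = (\<Sigma> \<union> {d}) - {c}
       then - (1 - t) * (- 1) ^ card (\<Sigma> \<inter> {c<..<d}) * t ^ card (\<Sigma> \<inter> {d<..}) else 0)"
  using assms by (simp_all add: ktheoretic_weight_def field_simps)

text \<open>Argument order of the R-weights: bottom-left, top-left, top-right, bottom-right.\<close>

fun R_weight :: "'a::field \<Rightarrow> 'a \<Rightarrow> 'a \<Rightarrow> hspin \<Rightarrow> hspin \<Rightarrow> hspin \<Rightarrow> hspin \<Rightarrow> 'a" where
  "R_weight t xi xj Plus Plus p p' =
    (if p = Plus \<and> p' = Plus then xj - t * xi else 0)"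
| "R_weight t xi xj (Color c) Plus p p' =
    (if p = Plus \<and> p' = Color c then (1 - t) * xi
     else if p = Color c \<and> p' = Plus then xi - xj
     else 0)"
| "R_weight t xi xj Plus (Color c) p p' =
    (if p = Color c \<and> p' = Plus then (1 - t) * xj
     else if p = Plus \<and> p' = Color c then t * (xi - xj)
     else 0)"
| "R_weight t xi xj (Color a) (Color b) p p' =
    (if a = b then
       (if p = Color a \<and> p' = Color a then xi - t * xj else 0)
     else if p = Color b \<and> p' = Color a then
       (if a < b then (1 - t) * xi else (1 - t) * xj)
     else if p = Color a \<and> p' = Color b then
       (if a < b then t * (xi - xj) else xi - xj)
     else 0)"

end

theory Submission
  imports Defs
begin

text \<open>
  The vertex conserves colors: the top spin and the left spin together carry the same colors as the
  bottom spin and the right spin. So the left, top and right spins of a vertex determine its bottom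
  spin, and the sums over \<open>\<Gamma>\<close> collapse. The R-vertex only permutes its two spins, so each side of the
  equation has at most two terms: on the left \<open>(p, p')\<close> is \<open>(b, a)\<close> or \<open>(a, b)\<close>, on the right it is
  \<open>(d, e)\<close> or \<open>(e, d)\<close>. If colors are not conserved between \<open>(a, b, c)\<close> and \<open>(d, e, f)\<close>, all terms vanish.

  What remains is an identity between these terms for each column state \<open>c\<close>. It reduces to finitely
  many cases because of a factorization of the vertex weight (\<open>whittaker_weight_eq_amplitude\<close>). A
  color \<open>k\<close> in the column that differs from the left spin \<open>L\<close> and the right spin \<open>L'\<close> contributes
  \<open>left_factor t L k * right_factor L' k\<close>, a function of \<open>L\<close> alone times a function of \<open>L'\<close> alone.
  In each term the two left spins are \<open>a\<close> and \<open>b\<close> and the two right spins are \<open>d\<close> and \<open>e\<close>, in some order.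
  Hence a spectator, that is, a color of \<open>c\<close> outside \<open>{a, b, d, e}\<close>, contributes the same factor to
  every term and can be removed (\<open>exchange_identity_spectators\<close>).

  Then at most four colors are left, and conservation determines which of them occupy the column,
  up to colors that occur both on the left side, in \<open>{a, b}\<close>, and on the right side, in \<open>{d, e}\<close>. The
  weights depend only on the relative order of these colors, so each pattern of coincidences among
  \<open>a, b, d, e\<close> gives a finite list of polynomial identities in \<open>t\<close>, \<open>xi\<close>, \<open>xj\<close> and \<open>y\<close>, which ring
  normalization proves.

  The K-theoretic case follows from the Whittaker case. The substitution of \<open>-x\<close> for \<open>x\<close> changes the
  sign of all R-weights, and the division by \<open>y\<close> multiplies every term by the same power of \<open>y\<close>,
  because the left spins of the two vertices are always \<open>a\<close> and \<open>b\<close>.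
\<close>

section \<open>Factorization of the vertex weights\<close>

fun color_set :: "hspin \<Rightarrow> nat set" where
  "color_set Plus = {}"
| "color_set (Color c) = {c}"

text \<open>
  In \<open>left_factor\<close> the spin \<open>Plus\<close> behaves like a label below all colors, in \<open>right_factor\<close> like a
  label above all colors. The sign \<open>-1\<close> of a right color exceeded by \<open>k\<close> cancels that of \<open>-t\<close>; this
  is how the mixture of \<open>t\<close>, \<open>-t\<close> and \<open>-1\<close> in the vertex weights arises.
\<close>

fun left_factor :: "'a::field \<Rightarrow> hspin \<Rightarrow> nat \<Rightarrow> 'a" where
  "left_factor t Plus k = - t"
| "left_factor t (Color c) k = (if c < k then - t else 1)"

fun right_factor :: "hspin \<Rightarrow> nat \<Rightarrow> 'a::field" where
  "right_factor Plus k = 1"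
| "right_factor (Color c) k = (if c < k then - 1 else 1)"

text \<open>
  The part of the vertex weight that does not see the spectators: it depends on \<open>\<Sigma>\<close> only through the
  presence of the left and the right color. For distinct spins it is zero if the left color would enter
  the column a second time or the right color is not there to leave.
\<close>

fun core_weight :: "'a::field \<Rightarrow> 'a \<Rightarrow> 'a \<Rightarrow> hspin \<Rightarrow> nat set \<Rightarrow> hspin \<Rightarrow> 'a" where
  "core_weight t x y Plus \<Sigma> Plus = 1"
| "core_weight t x y Plus \<Sigma> (Color d) = (if d \<in> \<Sigma> then 1 else 0)"
| "core_weight t x y (Color c) \<Sigma> Plus = (if c \<in> \<Sigma> then 0 else (1 - t) * x)"
| "core_weight t x y (Color c) \<Sigma> (Color d) =
    (if c = d then (if c \<in> \<Sigma> then x + t * y else x + y)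
     else if c \<in> \<Sigma> \<or> d \<notin> \<Sigma> then 0
     else if c < d then (1 - t) * x else - y * (1 - t))"

text \<open>
  Where \<open>core_weight\<close> is nonzero, \<open>\<Sigma> - color_set L'\<close> consists of the colors of \<open>\<Sigma>\<close> other than those
  of \<open>L\<close> and \<open>L'\<close>, so \<open>L\<close> and \<open>L'\<close> never act on themselves or on each other.
\<close>

definition amplitude :: "'a::field \<Rightarrow> 'a \<Rightarrow> 'a \<Rightarrow> hspin \<Rightarrow> nat set \<Rightarrow> hspin \<Rightarrow> 'a" where
  "amplitude t x y L \<Sigma> L' = core_weight t x y L \<Sigma> L' *
     (\<Prod>k\<in>\<Sigma> - color_set L'. left_factor t L k * right_factor L' k)"

text \<open>
  The case \<open>L = L'\<close> is separate because a color may pass horizontally without being in the column;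
  removing and adding it would then create it.
\<close>

definition bottom_spin :: "hspin \<Rightarrow> nat set \<Rightarrow> hspin \<Rightarrow> nat set" where
  "bottom_spin L \<Sigma> L' = (if L = L' then \<Sigma> else (\<Sigma> - color_set L') \<union> color_set L)"

text \<open>
  Every vertex weight is a product of at most two powers whose exponents count the colors of \<open>\<Sigma>\<close> in two
  ranges; this converts the product over single colors to that form.
\<close>

lemma prod_two_ranges:
  fixes u v :: "'a::field"
  assumes "finite \<Sigma>" and "D \<inter> A = {}" and "D \<inter> B = {}"
    and "\<And>k. k \<in> \<Sigma> - D \<Longrightarrow> g k = (if k \<in> A then u else 1) * (if k \<in> B then v else 1)"
  shows "(\<Prod>k\<in>\<Sigma> - D. g k) = u ^ card (\<Sigma> \<inter> A) * v ^ card (\<Sigma> \<inter> B)"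
proof -
  have "(\<Prod>k\<in>\<Sigma> - D. g k) =
      (\<Prod>k\<in>\<Sigma> - D. if k \<in> A then u else 1) * (\<Prod>k\<in>\<Sigma> - D. if k \<in> B then v else 1)"
    using assms(4) by (simp add: prod.distrib)
  moreover have "(\<Prod>k\<in>\<Sigma> - D. if k \<in> A then u else 1) = u ^ card (\<Sigma> \<inter> A)"
  proof -
    have "(\<Prod>k\<in>\<Sigma> - D. if k \<in> A then u else 1) = u ^ card ((\<Sigma> - D) \<inter> A)"
      using assms(1) by (simp flip: prod.inter_restrict)
    also have "(\<Sigma> - D) \<inter> A = \<Sigma> \<inter> A"
      using assms(2) by blast
    finally show ?thesis .
  qed
  moreover have "(\<Prod>k\<in>\<Sigma> - D. if k \<in> B then v else 1) = v ^ card (\<Sigma> \<inter> B)"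
  proof -
    have "(\<Prod>k\<in>\<Sigma> - D. if k \<in> B then v else 1) = v ^ card ((\<Sigma> - D) \<inter> B)"
      using assms(1) by (simp flip: prod.inter_restrict)
    also have "(\<Sigma> - D) \<inter> B = \<Sigma> \<inter> B"
      using assms(3) by blast
    finally show ?thesis .
  qed
  ultimately show ?thesis by simp
qed

text \<open>
  The single-color factors reproduce the exponents of the weights. For a left color \<open>c\<close> and a right
  color \<open>d\<close>, a color above both contributes \<open>(-t) * (-1) = t\<close>, a color strictly between them
  contributes \<open>-t\<close> if \<open>c < d\<close> and \<open>-1\<close> if \<open>d < c\<close>, and a color below both contributes \<open>1\<close>.
\<close>

lemma whittaker_weight_eq_amplitude:
  fixes t x y :: "'a::field"
  assumes "finite \<Sigma>"
  shows "whittaker_weight t x y L \<Sigma> L' \<Sigma>' =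
    (if \<Sigma>' = bottom_spin L \<Sigma> L' then amplitude t x y L \<Sigma> L' else 0)"
proof (cases L)
  case L: Plus
  show ?thesis
  proof (cases L')
    case Plus
    then show ?thesis
      using L by (simp add: amplitude_def bottom_spin_def)
  next
    case (Color d)
    have "(\<Prod>k\<in>\<Sigma> - {d}. - t * (right_factor (Color d) k)) =
        (- t) ^ card (\<Sigma> \<inter> {..<d}) * t ^ card (\<Sigma> \<inter> {d<..})"
      using assms by (intro prod_two_ranges) auto
    then show ?thesis
      using L Color by (simp add: amplitude_def bottom_spin_def)
  qed
next
  case L: (Color c)
  show ?thesis
  proof (cases L')
    case Plus
    have "(\<Prod>k\<in>\<Sigma> - {}. left_factor t (Color c) k) =
        (- t) ^ card (\<Sigma> \<inter> {c<..}) * 1 ^ card (\<Sigma> \<inter> {})"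
      using assms by (intro prod_two_ranges) auto
    then show ?thesis
      using L Plus by (auto simp add: amplitude_def bottom_spin_def)
  next
    case (Color d)
    consider "c = d" | "c < d" | "d < c" by linarith
    then show ?thesis
    proof cases
      case 1
      have "(\<Prod>k\<in>\<Sigma> - {c}. left_factor t (Color c) k * right_factor (Color c) k) =
          t ^ card (\<Sigma> \<inter> {c<..}) * 1 ^ card (\<Sigma> \<inter> {})"
        using assms by (intro prod_two_ranges) auto
      then show ?thesis
        using L Color 1 by (simp add: amplitude_def bottom_spin_def)
    next
      case 2
      have "(\<Prod>k\<in>\<Sigma> - {d}. left_factor t (Color c) k * right_factor (Color d) k) =
          (- t) ^ card (\<Sigma> \<inter> {c<..<d}) * t ^ card (\<Sigma> \<inter> {d<..})"
        using assms 2 by (intro prod_two_ranges) auto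
      then show ?thesis
        using L Color 2 by (auto simp add: amplitude_def bottom_spin_def)
    next
      case 3
      show ?thesis
      proof (cases "c \<in> \<Sigma>")
        case True
        then show ?thesis
          using L Color 3 by (simp add: amplitude_def)
      next
        case False
        then have "(\<Prod>k\<in>\<Sigma> - {d}. left_factor t (Color c) k * right_factor (Color d) k) =
            (- 1) ^ card (\<Sigma> \<inter> {d<..<c}) * t ^ card (\<Sigma> \<inter> {c<..})"
          using assms 3 by (intro prod_two_ranges) (auto simp: not_less le_less)
        moreover have "(\<Sigma> \<union> {c}) - {d} = bottom_spin L \<Sigma> L'"
          using L Color 3 by (auto simp: bottom_spin_def)
        ultimately show ?thesis
          using L Color 3 False by (simp add: amplitude_def)
      qed
    qed
  qed
qed

section \<open>Conservation of colors\<close>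

text \<open>
  Occupations are counted with multiplicity, because the two horizontal spins on one side may coincide.
  Spins of stacked vertices are collected in lists, so that one notion covers a single vertex and
  a stack of two.
\<close>

definition conserved :: "hspin list \<Rightarrow> nat set \<Rightarrow> hspin list \<Rightarrow> nat set \<Rightarrow> bool" where
  "conserved Ls \<Sigma> Ls' \<Sigma>' \<longleftrightarrow>
    (\<forall>k. of_bool (k \<in> \<Sigma>) + count_list Ls (Color k) =
         of_bool (k \<in> \<Sigma>') + count_list Ls' (Color k))"

text \<open>
  Conservation, unlike \<open>bottom_spin\<close>, adds up over stacked vertices and is symmetric in the two
  spins of each side. This allows terms with different intermediate spins to be compared.
\<close>

lemma bottom_spin_iff_conserved:
  assumes "amplitude t x y L \<Sigma> L' \<noteq> 0"
  shows "\<Sigma>' = bottom_spin L \<Sigma> L' \<longleftrightarrow> conserved [L] \<Sigma> [L'] \<Sigma>'"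
proof -
  have "core_weight t x y L \<Sigma> L' \<noteq> 0"
    using assms by (simp add: amplitude_def)
  then have "(k \<in> \<Sigma>' \<longleftrightarrow> k \<in> bottom_spin L \<Sigma> L') \<longleftrightarrow>
      of_bool (k \<in> \<Sigma>) + count_list [L] (Color k) =
        of_bool (k \<in> \<Sigma>') + count_list [L'] (Color k)" for k
    by (cases L; cases L') (auto simp: bottom_spin_def split: if_splits)
  then show ?thesis
    by (simp add: conserved_def set_eq_iff)
qed

lemma conserved_stack:
  assumes "conserved [p] \<Sigma> [d] \<Gamma>"
  shows "conserved [p'] \<Gamma> [e] \<Sigma>' \<longleftrightarrow> conserved [p, p'] \<Sigma> [d, e] \<Sigma>'"
proof -
  have two: "count_list [u, v] k = count_list [u] k + count_list [v] k" for u v k :: hspin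
    by simp
  have "of_bool (k \<in> \<Gamma>) + count_list [p'] (Color k) =
          of_bool (k \<in> \<Sigma>') + count_list [e] (Color k) \<longleftrightarrow>
        of_bool (k \<in> \<Sigma>) + count_list [p, p'] (Color k) =
          of_bool (k \<in> \<Sigma>') + count_list [d, e] (Color k)" for k
    using assms[unfolded conserved_def, rule_format, of k]
    unfolding two[of p] two[of d] by linarith
  then show ?thesis
    by (simp only: conserved_def)
qed

lemma conserved_swap:
  "conserved [q, p] \<Sigma> Ls' \<Sigma>' \<longleftrightarrow> conserved [p, q] \<Sigma> Ls' \<Sigma>'"
  "conserved Ls \<Sigma> [q, p] \<Sigma>' \<longleftrightarrow> conserved Ls \<Sigma> [p, q] \<Sigma>'"
proof -
  have "count_list [q, p] = count_list [p, q]"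
    by (simp add: fun_eq_iff)
  then show "conserved [q, p] \<Sigma> Ls' \<Sigma>' \<longleftrightarrow> conserved [p, q] \<Sigma> Ls' \<Sigma>'"
    and "conserved Ls \<Sigma> [q, p] \<Sigma>' \<longleftrightarrow> conserved Ls \<Sigma> [p, q] \<Sigma>'"
    by (simp_all only: conserved_def)
qed

definition stack_amplitude ::
  "'a::field \<Rightarrow> 'a \<Rightarrow> 'a \<Rightarrow> 'a \<Rightarrow> hspin \<Rightarrow> hspin \<Rightarrow> hspin \<Rightarrow> hspin \<Rightarrow> nat set \<Rightarrow> 'a" where
  "stack_amplitude t x x' y p d p' e \<Sigma> =
    amplitude t x y p \<Sigma> d * amplitude t x' y p' (bottom_spin p \<Sigma> d) e"

text \<open>
  Only one intermediate spin \<open>\<Gamma>\<close> contributes. If both amplitudes are nonzero, the upper vertex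
  conserves colors, so the lower one does exactly when the whole stack does.
\<close>

lemma sum_stacked_weights:
  fixes t x x' y :: "'a::field"
  assumes "finite \<Sigma>" and "\<Sigma> \<subseteq> V" and "finite V" and "color_set p \<subseteq> V"
  shows "(\<Sum>\<Gamma>\<in>Pow V. whittaker_weight t x y p \<Sigma> d \<Gamma> * whittaker_weight t x' y p' \<Gamma> e \<Sigma>') =
    (if conserved [p, p'] \<Sigma> [d, e] \<Sigma>' then stack_amplitude t x x' y p d p' e \<Sigma> else 0)"
proof -
  let ?\<Gamma> = "bottom_spin p \<Sigma> d"
  have \<Gamma>: "?\<Gamma> \<in> Pow V"
    using assms by (auto simp: bottom_spin_def)
  then have "finite ?\<Gamma>"
    using assms(3) finite_subset by blast
  have "(\<Sum>\<Gamma>\<in>Pow V. whittaker_weight t x y p \<Sigma> d \<Gamma> * whittaker_weight t x' y p' \<Gamma> e \<Sigma>') =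
      (\<Sum>\<Gamma>\<in>Pow V. if \<Gamma> = ?\<Gamma>
         then amplitude t x y p \<Sigma> d * whittaker_weight t x' y p' ?\<Gamma> e \<Sigma>' else 0)"
    by (intro sum.cong refl) (auto simp: whittaker_weight_eq_amplitude[OF assms(1)])
  also have "\<dots> = amplitude t x y p \<Sigma> d * whittaker_weight t x' y p' ?\<Gamma> e \<Sigma>'"
    using \<Gamma> assms(3) by simp
  also have "\<dots> =
      (if conserved [p, p'] \<Sigma> [d, e] \<Sigma>' then stack_amplitude t x x' y p d p' e \<Sigma> else 0)"
  proof (cases "stack_amplitude t x x' y p d p' e \<Sigma> = 0")
    case True
    then show ?thesis
      by (auto simp: stack_amplitude_def whittaker_weight_eq_amplitude[OF \<open>finite ?\<Gamma>\<close>])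
  next
    case False
    then have top: "amplitude t x y p \<Sigma> d \<noteq> 0"
      and bottom: "amplitude t x' y p' ?\<Gamma> e \<noteq> 0"
      by (auto simp: stack_amplitude_def)
    have "conserved [p] \<Sigma> [d] ?\<Gamma>"
      using bottom_spin_iff_conserved[OF top] by blast
    then show ?thesis
      using bottom_spin_iff_conserved[OF bottom] conserved_stack
      by (auto simp: stack_amplitude_def whittaker_weight_eq_amplitude[OF \<open>finite ?\<Gamma>\<close>])
  qed
  finally show ?thesis .
qed

section \<open>The exchange identity\<close>

text \<open>
  The Yang--Baxter equation after the sums have collapsed to the two outcomes at each R-vertex,
  as a condition on the column state \<open>\<Sigma>\<close> above the two rows. The conditionals avoid counting the single
  outcome for two equal spins twice.
\<close>

definition exchange_identity ::
  "'a::field \<Rightarrow> 'a \<Rightarrow> 'a \<Rightarrow> 'a \<Rightarrow> hspin \<Rightarrow> hspin \<Rightarrow> hspin \<Rightarrow> hspin \<Rightarrow> nat set \<Rightarrow> bool" where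
  "exchange_identity t xi xj y a b d e \<Sigma> \<longleftrightarrow>
    R_weight t xi xj a b b a * stack_amplitude t xi xj y b d a e \<Sigma> +
    (if a = b then 0 else R_weight t xi xj a b a b * stack_amplitude t xi xj y a d b e \<Sigma>) =
    stack_amplitude t xj xi y b d a e \<Sigma> * R_weight t xi xj e d d e +
    (if d = e then 0 else stack_amplitude t xj xi y b e a d \<Sigma> * R_weight t xi xj d e d e)"

lemma amplitude_spectators:
  assumes "finite \<Sigma>" and "finite U" and "\<Sigma> \<inter> U = {}"
    and "color_set L \<inter> U = {}" and "color_set L' \<inter> U = {}"
  shows "amplitude t x y L (\<Sigma> \<union> U) L' =
    (\<Prod>k\<in>U. left_factor t L k) * (\<Prod>k\<in>U. right_factor L' k) * amplitude t x y L \<Sigma> L'"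
proof -
  have "(\<Sigma> \<union> U) - color_set L' = (\<Sigma> - color_set L') \<union> U"
    and "(\<Sigma> - color_set L') \<inter> U = {}"
    using assms by blast+
  then have "(\<Prod>k\<in>(\<Sigma> \<union> U) - color_set L'. left_factor t L k * right_factor L' k) =
      (\<Prod>k\<in>\<Sigma> - color_set L'. left_factor t L k * right_factor L' k) *
      (\<Prod>k\<in>U. left_factor t L k * right_factor L' k)"
    using assms(1,2) by (simp add: prod.union_disjoint)
  moreover have "core_weight t x y L (\<Sigma> \<union> U) L' = core_weight t x y L \<Sigma> L'"
    using assms by (cases L; cases L') auto
  ultimately show ?thesis
    by (simp add: amplitude_def prod.distrib)
qed

lemma stack_amplitude_spectators:
  assumes "finite \<Sigma>" and "finite U" and "\<Sigma> \<inter> U = {}"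
    and "color_set p \<inter> U = {}" and "color_set d \<inter> U = {}"
    and "color_set p' \<inter> U = {}" and "color_set e \<inter> U = {}"
  shows "stack_amplitude t x x' y p d p' e (\<Sigma> \<union> U) =
    (\<Prod>k\<in>U. left_factor t p k) * (\<Prod>k\<in>U. left_factor t p' k) *
    (\<Prod>k\<in>U. right_factor d k) * (\<Prod>k\<in>U. right_factor e k) *
    stack_amplitude t x x' y p d p' e \<Sigma>"
proof -
  have "bottom_spin p (\<Sigma> \<union> U) d = bottom_spin p \<Sigma> d \<union> U"
    using assms by (auto simp: bottom_spin_def)
  moreover have "finite (bottom_spin p \<Sigma> d)" "bottom_spin p \<Sigma> d \<inter> U = {}"
    using assms by (cases p; auto simp: bottom_spin_def)+
  ultimately show ?thesis
    using assms by (simp add: stack_amplitude_def amplitude_spectators)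
qed

text \<open>
  The factor of \<open>U\<close> is symmetric in the two left spins and in the two right spins, hence common to
  all four terms. It is only multiplied in, so it may vanish.
\<close>

lemma exchange_identity_spectators:
  assumes "exchange_identity t xi xj y a b d e \<Sigma>"
    and "finite \<Sigma>" and "finite U" and "\<Sigma> \<inter> U = {}"
    and "color_set a \<inter> U = {}" and "color_set b \<inter> U = {}"
    and "color_set d \<inter> U = {}" and "color_set e \<inter> U = {}"
  shows "exchange_identity t xi xj y a b d e (\<Sigma> \<union> U)"
proof -
  define g where "g = (\<Prod>k\<in>U. left_factor t a k) * (\<Prod>k\<in>U. left_factor t b k) *
    (\<Prod>k\<in>U. right_factor d k) * (\<Prod>k\<in>U. right_factor e k)"
  have g: "stack_amplitude t x x' y p p1 p' p2 (\<Sigma> \<union> U) =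
      g * stack_amplitude t x x' y p p1 p' p2 \<Sigma>"
    if "(p, p') \<in> {(a, b), (b, a)}" "(p1, p2) \<in> {(d, e), (e, d)}" for x x' p p' p1 p2
    using that assms(2-) by (auto simp: stack_amplitude_spectators g_def mult_ac)
  let ?L = "\<lambda>S. R_weight t xi xj a b b a * stack_amplitude t xi xj y b d a e S +
    (if a = b then 0 else R_weight t xi xj a b a b * stack_amplitude t xi xj y a d b e S)"
  let ?R = "\<lambda>S. stack_amplitude t xj xi y b d a e S * R_weight t xi xj e d d e +
    (if d = e then 0 else stack_amplitude t xj xi y b e a d S * R_weight t xi xj d e d e)"
  have "?L (\<Sigma> \<union> U) = g * ?L \<Sigma>"
    by (simp add: g algebra_simps)
  moreover have "?R (\<Sigma> \<union> U) = g * ?R \<Sigma>"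
    by (simp add: g algebra_simps)
  moreover have "?L \<Sigma> = ?R \<Sigma>"
    using assms(1) by (simp only: exchange_identity_def)
  ultimately show ?thesis
    by (simp only: exchange_identity_def)
qed

text \<open>
  Allows the order of the colors of two spins to be fixed before the spins are split into cases. The
  value at \<open>Plus\<close> is arbitrary: no weight compares \<open>Plus\<close> with a color by this number.
\<close>

fun color_of :: "hspin \<Rightarrow> nat" where
  "color_of Plus = 0"
| "color_of (Color c) = c"

lemmas exchange_simps =
  exchange_identity_def stack_amplitude_def amplitude_def bottom_spin_def

text \<open>
  The same spins enter on the left and leave on the right, so each color may be in the column or not.
\<close>

lemma exchange_identity_equal_sides:
  assumes "X = {} \<or> X = color_set a" and "Y = {} \<or> Y = color_set b"
  shows "exchange_identity t xi xj y a b a b (X \<union> Y)"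
    and "exchange_identity t xi xj y a b b a (X \<union> Y)"
  unfolding exchange_simps using assms
  by (elim disjE; cases "color_of a < color_of b"; cases a; cases b;
      simp add: insert_Diff_if insert_commute algebra_simps)+

text \<open>
  Only \<open>a\<close> is known to occur on both sides. The other outgoing spin \<open>e\<close> must come from the column and the
  other incoming spin \<open>b\<close> goes there, so \<open>e\<close> is present and \<open>b\<close> is absent; the presence of \<open>a\<close> is
  free, unless \<open>a\<close> equals \<open>b\<close> (then it is absent) or \<open>e\<close> (then it is present).
\<close>

lemma exchange_identity_a_shared:
  assumes "X = {} \<or> X = color_set a \<and> a \<noteq> b \<and> a \<noteq> e" and "b \<noteq> e"
  shows "exchange_identity t xi xj y a b a e (color_set e \<union> X)"
    and "exchange_identity t xi xj y a b e a (color_set e \<union> X)"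
  unfolding exchange_simps using assms
  by (elim disjE; cases "color_of a < color_of b"; cases "color_of a < color_of e";
      cases "color_of b < color_of e"; cases a; cases b; cases e;
      simp add: insert_Diff_if insert_commute algebra_simps)+

lemma exchange_identity_b_shared:
  assumes "X = {} \<or> X = color_set b \<and> b \<noteq> a \<and> b \<noteq> e" and "a \<noteq> e"
  shows "exchange_identity t xi xj y a b b e (color_set e \<union> X)"
    and "exchange_identity t xi xj y a b e b (color_set e \<union> X)"
  unfolding exchange_simps using assms
  by (elim disjE; cases "color_of a < color_of b"; cases "color_of a < color_of e";
      cases "color_of b < color_of e"; cases a; cases b; cases e;
      simp add: insert_Diff_if insert_commute algebra_simps)+

text \<open>
  The generic case, in which two colors leave the column and two others enter it. Comparing the six
  pairs covers the 24 orders; the inconsistent combinations are discharged by linear arithmetic.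
\<close>

lemma exchange_identity_four_colors:
  assumes "distinct [a, b, d, e]"
  shows "exchange_identity t xi xj y (Color a) (Color b) (Color d) (Color e) {d, e}"
proof -
  have "a \<noteq> b" "a \<noteq> d" "a \<noteq> e" "b \<noteq> d" "b \<noteq> e" "d \<noteq> e"
    using assms by auto
  then show ?thesis
    unfolding exchange_simps
    \<comment> \<open>The products are evaluated before the order is fixed, without splitting conditionals.\<close>
    by (simp add: insert_Diff_if split del: if_split;
        cases "a < b"; cases "a < d"; cases "b < d"; cases "a < e"; cases "b < e"; cases "d < e";
        simp add: algebra_simps)
qed
text \<open>
  No spin occurs on both sides, so the outgoing colors are all in the column and the incoming ones are
  not. Two equal spins on one side must be \<open>Plus\<close>, since the column holds each color at most once.
\<close>

lemma exchange_identity_disjoint_sides: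
  assumes "a \<noteq> d" "a \<noteq> e" "b \<noteq> d" "b \<noteq> e" and "a = b \<longrightarrow> a = Plus" and "d = e \<longrightarrow> d = Plus"
  shows "exchange_identity t xi xj y a b d e (color_set d \<union> color_set e)"
proof (cases "Plus \<in> {a, b, d, e}")
  case True
  then show ?thesis
    unfolding exchange_simps using assms
    by (cases a; cases b; cases d; cases e; simp add: insert_Diff_if insert_commute algebra_simps)
next
  case False
  then show ?thesis
    using assms
    by (cases a; cases b; cases d; cases e)
      (simp_all add: exchange_identity_four_colors insert_commute)
qed

text \<open>
  The set \<open>c \<inter> K\<close> of occupied colors among the spins of the four edges has, by conservation, one of the
  shapes treated above, and all other colors of \<open>c\<close> are spectators.
\<close>

lemma exchange_identity_conserved:
  assumes "finite c" and "conserved [a, b] c [d, e] f"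
  shows "exchange_identity t xi xj y a b d e c"
proof -
  define K where "K = color_set a \<union> color_set b \<union> color_set d \<union> color_set e"
  have color_set_iff: "k \<in> color_set L \<longleftrightarrow> L = Color k" for k L
    by (cases L) auto
  have at: "of_bool (k \<in> c) + of_bool (a = Color k) + of_bool (b = Color k) =
      of_bool (k \<in> f) + of_bool (d = Color k) + (of_bool (e = Color k) :: nat)" for k
    using assms(2)[unfolded conserved_def, rule_format, of k]
    by (auto simp: of_bool_def split: if_splits)
  have sub: "c \<inter> color_set L = {} \<or> c \<inter> color_set L = color_set L" for L
    by (cases L) auto
  \<comment> \<open>In the cases \<open>ad\<close> to \<open>be\<close> the shared spin may equal a third one; its color is then either
    excluded from \<open>c\<close> or already in the color set of the other outgoing spin, so \<open>X\<close> is empty.\<close>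
  consider (same) "a = d" "b = e" | (swap) "a = e" "b = d"
    | (ad) "a = d" "b \<noteq> e" | (ae) "a = e" "b \<noteq> d" | (bd) "b = d" "a \<noteq> e" | (be) "b = e" "a \<noteq> d"
    | (disjoint) "a \<noteq> d" "a \<noteq> e" "b \<noteq> d" "b \<noteq> e"
    by blast
  then have "exchange_identity t xi xj y a b d e (c \<inter> K)"
  proof cases
    case same
    have "c \<inter> K = (c \<inter> color_set a) \<union> (c \<inter> color_set b)"
      using same by (auto simp: K_def)
    then show ?thesis
      using exchange_identity_equal_sides(1)[OF sub[of a] sub[of b]] same by simp
  next
    case swap
    have "c \<inter> K = (c \<inter> color_set a) \<union> (c \<inter> color_set b)"
      using swap by (auto simp: K_def)
    then show ?thesis
      using exchange_identity_equal_sides(2)[OF sub[of a] sub[of b]] swap by simp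
  next
    case ad
    define X where "X = (if a = b \<or> a = e then {} else c \<inter> color_set a)"
    have "k \<in> c \<inter> K \<longleftrightarrow> k \<in> color_set e \<union> X" for k
      using at[of k] ad by (auto simp: K_def X_def color_set_iff of_bool_def split: if_splits)
    then have "c \<inter> K = color_set e \<union> X" by blast
    moreover have "X = {} \<or> X = color_set a \<and> a \<noteq> b \<and> a \<noteq> e"
      using sub[of a] by (auto simp: X_def)
    ultimately show ?thesis
      using exchange_identity_a_shared(1) ad by metis
  next
    case ae
    define X where "X = (if a = b \<or> a = d then {} else c \<inter> color_set a)"
    have "k \<in> c \<inter> K \<longleftrightarrow> k \<in> color_set d \<union> X" for k
      using at[of k] ae by (auto simp: K_def X_def color_set_iff of_bool_def split: if_splits)
    then have "c \<inter> K = color_set d \<union> X" by blast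
    moreover have "X = {} \<or> X = color_set a \<and> a \<noteq> b \<and> a \<noteq> d"
      using sub[of a] by (auto simp: X_def)
    ultimately show ?thesis
      using exchange_identity_a_shared(2) ae by metis
  next
    case bd
    define X where "X = (if b = a \<or> b = e then {} else c \<inter> color_set b)"
    have "k \<in> c \<inter> K \<longleftrightarrow> k \<in> color_set e \<union> X" for k
      using at[of k] bd by (auto simp: K_def X_def color_set_iff of_bool_def split: if_splits)
    then have "c \<inter> K = color_set e \<union> X" by blast
    moreover have "X = {} \<or> X = color_set b \<and> b \<noteq> a \<and> b \<noteq> e"
      using sub[of b] by (auto simp: X_def)
    ultimately show ?thesis
      using exchange_identity_b_shared(1) bd by metis
  next
    case be
    define X where "X = (if b = a \<or> b = d then {} else c \<inter> color_set b)"
    have "k \<in> c \<inter> K \<longleftrightarrow> k \<in> color_set d \<union> X" for k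
      using at[of k] be by (auto simp: K_def X_def color_set_iff of_bool_def split: if_splits)
    then have "c \<inter> K = color_set d \<union> X" by blast
    moreover have "X = {} \<or> X = color_set b \<and> b \<noteq> a \<and> b \<noteq> d"
      using sub[of b] by (auto simp: X_def)
    ultimately show ?thesis
      using exchange_identity_b_shared(2) be by metis
  next
    case disjoint
    have "k \<in> c \<inter> K \<longleftrightarrow> k \<in> color_set d \<union> color_set e" for k
      using at[of k] disjoint by (auto simp: K_def color_set_iff of_bool_def split: if_splits)
    then have "c \<inter> K = color_set d \<union> color_set e" by blast
    moreover have "a = b \<longrightarrow> a = Plus"
    proof (cases a)
      case (Color k)
      then show ?thesis using at[of k] disjoint by (auto simp: of_bool_def split: if_splits)
    qed simp
    moreover have "d = e \<longrightarrow> d = Plus"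
    proof (cases d)
      case (Color k)
      then show ?thesis using at[of k] disjoint by (auto simp: of_bool_def split: if_splits)
    qed simp
    ultimately show ?thesis
      using exchange_identity_disjoint_sides disjoint by metis
  qed
  then have "exchange_identity t xi xj y a b d e ((c \<inter> K) \<union> (c - K))"
    by (rule exchange_identity_spectators) (use assms(1) in \<open>auto simp: K_def\<close>)
  then show ?thesis
    by (simp add: Int_Diff_Un)
qed

section \<open>The Yang--Baxter equation\<close>

lemma R_weight_eq_0:
  assumes "(p, p') \<noteq> (b, a)" and "(p, p') \<noteq> (a, b)"
  shows "R_weight t xi xj a b p p' = 0"
proof (cases "a = b")
  case True
  then show ?thesis
    using assms by (cases b) auto
next
  case False
  have "p = b \<longrightarrow> p' \<noteq> a" "p = a \<longrightarrow> p' \<noteq> b"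
    using assms by auto
  then show ?thesis
    using False by (cases a; cases b) auto
qed

text \<open>Intended for the two spins next to an R-vertex, which are those on its other side in some order.\<close>

lemma sum_swapped_pair:
  fixes G :: "'b \<Rightarrow> 'b \<Rightarrow> 'c::comm_monoid_add"
  assumes "finite H" and "p \<in> H" and "q \<in> H"
    and "\<And>u v. (u, v) \<noteq> (p, q) \<Longrightarrow> (u, v) \<noteq> (q, p) \<Longrightarrow> G u v = 0"
  shows "(\<Sum>u\<in>H. \<Sum>v\<in>H. G u v) = G p q + (if p = q then 0 else G q p)"
proof -
  have "(\<Sum>u\<in>H. \<Sum>v\<in>H. G u v) = (\<Sum>(u, v)\<in>H \<times> H. G u v)"
    by (simp add: sum.cartesian_product)
  also have "\<dots> = (\<Sum>(u, v)\<in>{(p, q), (q, p)}. G u v)"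
    using assms by (intro sum.mono_neutral_right) auto
  also have "\<dots> = G p q + (if p = q then 0 else G q p)"
    by (cases "p = q") simp_all
  finally show ?thesis .
qed

lemma whittaker_yang_baxter:
  fixes t xi xj y :: "'k::field"
  assumes H: "a \<in> hspins r" "b \<in> hspins r" "d \<in> hspins r" "e \<in> hspins r"
    and c: "c \<subseteq> {1..r}"
  shows
    "(\<Sum>p\<in>hspins r. \<Sum>p'\<in>hspins r. \<Sum>\<Gamma>\<in>Pow {1..r}.
        R_weight t xi xj a b p p' *
          whittaker_weight t xi y p c d \<Gamma> * whittaker_weight t xj y p' \<Gamma> e f)
   = (\<Sum>p\<in>hspins r. \<Sum>p'\<in>hspins r. \<Sum>\<Gamma>\<in>Pow {1..r}.
        whittaker_weight t xj y b c p \<Gamma> * whittaker_weight t xi y a \<Gamma> p' f *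
          R_weight t xi xj p' p d e)"
    (is "?lhs = ?rhs")
proof -
  have fin: "finite (hspins r)" "finite c"
    using c finite_subset by (auto simp: hspins_def)
  have sub: "color_set p \<subseteq> {1..r}" if "p \<in> hspins r" for p
    using that by (auto simp: hspins_def)
  have swaps: "conserved [b, a] c [d, e] f \<longleftrightarrow> conserved [a, b] c [d, e] f"
    "conserved [b, a] c [e, d] f \<longleftrightarrow> conserved [a, b] c [d, e] f"
    by (metis conserved_swap)+
  define P where "P p p' = (if conserved [p, p'] c [d, e] f
    then stack_amplitude t xi xj y p d p' e c else 0)" for p p'
  define Q where "Q p p' = (if conserved [b, a] c [p, p'] f
    then stack_amplitude t xj xi y b p a p' c else 0)" for p p'
  have "?lhs = (\<Sum>p\<in>hspins r. \<Sum>p'\<in>hspins r. R_weight t xi xj a b p p' * P p p')"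
  proof (intro sum.cong refl)
    fix p p' assume "p \<in> hspins r"
    then show "(\<Sum>\<Gamma>\<in>Pow {1..r}. R_weight t xi xj a b p p' *
          whittaker_weight t xi y p c d \<Gamma> * whittaker_weight t xj y p' \<Gamma> e f) =
        R_weight t xi xj a b p p' * P p p'"
      unfolding P_def mult.assoc sum_distrib_left[symmetric]
      by (subst sum_stacked_weights) (use fin c sub in auto)
  qed
  also have "\<dots> = R_weight t xi xj a b b a * P b a +
      (if b = a then 0 else R_weight t xi xj a b a b * P a b)"
    using fin(1) H by (intro sum_swapped_pair) (auto intro: R_weight_eq_0)
  also have "\<dots> = Q d e * R_weight t xi xj e d d e +
      (if d = e then 0 else Q e d * R_weight t xi xj d e d e)"
  proof (cases "conserved [a, b] c [d, e] f")
    case True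
    then have "P b a = stack_amplitude t xi xj y b d a e c"
      and "P a b = stack_amplitude t xi xj y a d b e c"
      and "Q d e = stack_amplitude t xj xi y b d a e c"
      and "Q e d = stack_amplitude t xj xi y b e a d c"
      using swaps by (simp_all add: P_def Q_def)
    then show ?thesis
      using exchange_identity_conserved[OF fin(2) True, of t xi xj y]
      by (cases "a = b") (simp_all add: exchange_identity_def)
  next
    case False
    then show ?thesis
      by (simp add: P_def Q_def swaps)
  qed
  also have "\<dots> = (\<Sum>p\<in>hspins r. \<Sum>p'\<in>hspins r. Q p p' * R_weight t xi xj p' p d e)"
    using fin(1) H by (intro sum_swapped_pair[symmetric]) (auto intro: R_weight_eq_0)
  also have "\<dots> = ?rhs"
  proof (intro sum.cong refl)
    fix p p'
    show "Q p p' * R_weight t xi xj p' p d e =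
        (\<Sum>\<Gamma>\<in>Pow {1..r}. whittaker_weight t xj y b c p \<Gamma> *
          whittaker_weight t xi y a \<Gamma> p' f * R_weight t xi xj p' p d e)"
      unfolding Q_def sum_distrib_right[symmetric]
      by (subst sum_stacked_weights) (use fin c sub H in auto)
  qed
  finally show ?thesis .
qed

text \<open>The R-weights are homogeneous of degree one in \<open>(xi, xj)\<close>.\<close>

lemma R_weight_uminus: "R_weight t (- xi) (- xj) a b p p' = - R_weight t xi xj a b p p'"
proof (cases "(p, p') = (b, a) \<or> (p, p') = (a, b)")
  case True
  then show ?thesis
    by (elim disjE; cases a; cases b; simp add: algebra_simps)
qed (simp add: R_weight_eq_0)

text \<open>
  With \<open>\<kappa> L\<close> the factor \<open>1\<close> or \<open>1/y\<close> that a left spin \<open>L\<close> receives, both sides are those of the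
  Whittaker case at \<open>(-xi, -xj)\<close>, multiplied by \<open>-(\<kappa> a * \<kappa> b)\<close>. On the left side this uses that the
  R-vertex permutes \<open>a\<close> and \<open>b\<close>.
\<close>

lemma ktheoretic_yang_baxter:
  fixes t xi xj y :: "'k::field"
  assumes "a \<in> hspins r" "b \<in> hspins r" "d \<in> hspins r" "e \<in> hspins r"
    and "c \<subseteq> {1..r}"
  shows
    "(\<Sum>p\<in>hspins r. \<Sum>p'\<in>hspins r. \<Sum>\<Gamma>\<in>Pow {1..r}.
        R_weight t xi xj a b p p' *
          ktheoretic_weight t xi y p c d \<Gamma> * ktheoretic_weight t xj y p' \<Gamma> e f)
   = (\<Sum>p\<in>hspins r. \<Sum>p'\<in>hspins r. \<Sum>\<Gamma>\<in>Pow {1..r}.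
        ktheoretic_weight t xj y b c p \<Gamma> * ktheoretic_weight t xi y a \<Gamma> p' f *
          R_weight t xi xj p' p d e)"
    (is "?lhs = ?rhs")
proof -
  define \<kappa> where "\<kappa> L = (case L of Plus \<Rightarrow> 1 | Color c \<Rightarrow> inverse y)" for L
  let ?W = "\<lambda>x. whittaker_weight t (- x) y" and ?R = "R_weight t (- xi) (- xj)"
  have k: "ktheoretic_weight t x y L \<Sigma> L' \<Sigma>' = \<kappa> L * ?W x L \<Sigma> L' \<Sigma>'" for x L \<Sigma> L' \<Sigma>'
    by (simp add: ktheoretic_weight_def \<kappa>_def divide_inverse mult.commute split: hspin.split)
  have R: "R_weight t xi xj a b p p' * (\<kappa> p * \<kappa> p') = - (\<kappa> a * \<kappa> b) * ?R a b p p'" for p p'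
  proof (cases "(p, p') = (b, a) \<or> (p, p') = (a, b)")
    case True
    then show ?thesis
      by (elim disjE) (simp_all add: R_weight_uminus)
  next
    case False
    then show ?thesis
      by (simp add: R_weight_eq_0)
  qed
  have "R_weight t xi xj a b p p' * ktheoretic_weight t xi y p c d \<Gamma> *
        ktheoretic_weight t xj y p' \<Gamma> e f =
      - (\<kappa> a * \<kappa> b) * (?R a b p p' * ?W xi p c d \<Gamma> * ?W xj p' \<Gamma> e f)" for p p' \<Gamma>
  proof -
    have "R_weight t xi xj a b p p' * ktheoretic_weight t xi y p c d \<Gamma> *
        ktheoretic_weight t xj y p' \<Gamma> e f =
      R_weight t xi xj a b p p' * (\<kappa> p * \<kappa> p') * (?W xi p c d \<Gamma> * ?W xj p' \<Gamma> e f)"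
      by (simp only: k mult_ac)
    then show ?thesis
      by (simp only: R mult.assoc)
  qed
  then have "?lhs = - (\<kappa> a * \<kappa> b) * (\<Sum>p\<in>hspins r. \<Sum>p'\<in>hspins r. \<Sum>\<Gamma>\<in>Pow {1..r}.
      ?R a b p p' * ?W xi p c d \<Gamma> * ?W xj p' \<Gamma> e f)"
    by (simp only: sum_distrib_left)
  also have "\<dots> = - (\<kappa> a * \<kappa> b) * (\<Sum>p\<in>hspins r. \<Sum>p'\<in>hspins r. \<Sum>\<Gamma>\<in>Pow {1..r}.
      ?W xj b c p \<Gamma> * ?W xi a \<Gamma> p' f * ?R p' p d e)"
    using whittaker_yang_baxter[OF assms, of t "- xi" "- xj" y f] by simp
  also have "\<dots> = ?rhs"
    unfolding sum_distrib_left by (intro sum.cong refl) (simp add: k R_weight_uminus mult_ac)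
  finally show ?thesis .
qed

theorem theorem3p7:
  fixes r :: nat
    and t xi xj y :: "'k::field"
    and T :: "'k \<Rightarrow> 'k \<Rightarrow> hspin \<Rightarrow> nat set \<Rightarrow> hspin \<Rightarrow> nat set \<Rightarrow> 'k"
    and a b d e :: hspin
    and c f :: "nat set"
  assumes "r \<ge> 1"
    and "T = whittaker_weight t \<or> (T = ktheoretic_weight t \<and> y \<noteq> 0)"
    and "a \<in> hspins r" and "b \<in> hspins r" and "d \<in> hspins r" and "e \<in> hspins r"
    and "c \<subseteq> {1..r}" and "f \<subseteq> {1..r}"
  shows
    "(\<Sum>p\<in>hspins r. \<Sum>p'\<in>hspins r. \<Sum>\<Gamma>\<in>Pow {1..r}.
        R_weight t xi xj a b p p' * T xi y p c d \<Gamma> * T xj y p' \<Gamma> e f)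
   = (\<Sum>p\<in>hspins r. \<Sum>p'\<in>hspins r. \<Sum>\<Gamma>\<in>Pow {1..r}.
        T xj y b c p \<Gamma> * T xi y a \<Gamma> p' f * R_weight t xi xj p' p d e)"
  using assms(2) whittaker_yang_baxter[OF assms(3-7)] ktheoretic_yang_baxter[OF assms(3-7)]
  by blast

end
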